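(* Consider the $L$-layer LSTM described in the context, regarded as a discrete-time system with state $s(t)=(s^{(1)}(t),\dots,s^{(L)}(t))$ and input $u(t)=(x(t),b^{(1)}_c,\dots,b^{(L)}_c)$, and let $k\in\mathbb{Z}_{\ge0}$. Suppose $\rho(A^{(l)}(k))<1$ for all $l\in[L]$, where $A^{(l)}(k)=\begin{bmatrix}\overline{\sigma}^{(l)}_f(k)&\overline{\sigma}^{(l)}_i(k)\|U^{(l)}_c\|\\ \overline{\sigma}^{(l)}_o(k)\overline{\sigma}^{(l)}_f(k)&\overline{\sigma}^{(l)}_o(k)\overline{\sigma}^{(l)}_i(k)\|U^{(l)}_c\|\end{bmatrix}$. Then the LSTM is input-to-state stable for initial states in $\prod_{l=1}^L\mathcal{S}^{(l)}(k)$: there exist continuous $\beta\in\mathcal{KL}$ and $\gamma\in\mathcal{K}_\infty$ such that for every initial state $s(0)$ with $s^{(l)}(0)\in\mathcal{S}^{(l)}(k)$ for all $l\in[L]$, every input sequence with $x(\tau)\in[-x_{\max},x_{\max}]^{n_x}$, and every $t\in\mathbb{Z}_{\ge0}$, $\|s(t)\|\le\beta(\|s(0)\|,t)+\gamma(\|u(0:t)\|_{2,\infty})$. Furthermore, $\rho(A^{(l)}(k+1))\le\rho(A^{(l)}(k))$ for all $k\in\mathbb{Z}_{\ge0}$ and $l\in[L]$.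
   Context: LSTM: fix $L\in\mathbb{N}$, dimensions $n_x,n_c$, $x_{\max}>0$. For $l\in[L]$ let $n^{(l)}=n_x$ if $l=1$, $n^{(l)}=n_c$ if $l\ge2$; weights $W^{(l)}_*\in\mathbb{R}^{n_c\times n^{(l)}}$, $U^{(l)}_*\in\mathbb{R}^{n_c\times n_c}$, biases $b^{(l)}_*\in\mathbb{R}^{n_c}$, $*\in\{f,i,c,o\}$. With $\sigma(w)=1/(1+e^{-w})$, $\phi=\tanh$, $\odot$ componentwise product: $c^{(l)}(t+1)=\sigma(W^{(l)}_f x^{(l)}(t)+U^{(l)}_f h^{(l)}(t)+b^{(l)}_f)\odot c^{(l)}(t)+\sigma(W^{(l)}_i x^{(l)}(t)+U^{(l)}_i h^{(l)}(t)+b^{(l)}_i)\odot\phi(W^{(l)}_c x^{(l)}(t)+U^{(l)}_c h^{(l)}(t)+b^{(l)}_c)$, $h^{(l)}(t+1)=\sigma(W^{(l)}_o x^{(l)}(t)+U^{(l)}_o h^{(l)}(t)+b^{(l)}_o)\odot\phi(c^{(l)}(t+1))$, with $x^{(1)}(t)=x(t)$, $x^{(l)}(t)=h^{(l-1)}(t+1)$ for $l\ge2$; $s^{(l)}=(c^{(l)},h^{(l)})$. Quantities: $x^{(l)}_{\max}=x_{\max}$ if $l=1$, $=1$ if $l\ge2$; $|A|$ entrywise absolute value; $\mathbf{1}_n$ all-ones vector; $v_+$ componentwise positive part; $\|\cdot\|_\infty$ max norm. For $\eta\ge0$, $*\in\{f,i,o\}$: $G^{(l)}_*(\eta)=\|(x^{(l)}_{\max}|W^{(l)}_*|\mathbf{1}_{n^{(l)}}+\eta|U^{(l)}_*|\mathbf{1}_{n_c}+b^{(l)}_*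 )_+\|_\infty$, $G^{(l)}_c(\eta)=\|x^{(l)}_{\max}|W^{(l)}_c|\mathbf{1}_{n^{(l)}}+\eta|U^{(l)}_c|\mathbf{1}_{n_c}+|b^{(l)}_c|\|_\infty$. With $\eta^{(l)}(-1)=1$, $k\ge0$: $\overline{\sigma}^{(l)}_*(k)=\sigma(G^{(l)}_*(\eta^{(l)}(k-1)))$, $\overline{\phi}^{(l)}_c(k)=\phi(G^{(l)}_c(\eta^{(l)}(k-1)))$, $\overline{c}^{(l)}(k)=\overline{\sigma}^{(l)}_i(k)\overline{\phi}^{(l)}_c(k)/(1-\overline{\sigma}^{(l)}_f(k))$, $\eta^{(l)}(k)=\phi(\overline{c}^{(l)}(k))\overline{\sigma}^{(l)}_o(k)$. $\mathcal{S}^{(l)}(k)=\{(c,h):\|c\|_\infty\le\overline{c}^{(l)}(k),\|h\|_\infty\le\phi(\overline{c}^{(l)}(k))\overline{\sigma}^{(l)}_o(k)\}$. $\|\cdot\|$ is the Euclidean norm / induced 2-norm, $\rho$ the spectral radius, and $\|u(0:t)\|_{2,\infty}=\max_{0\le\tau\le t}\|u(\tau)\|_2$. Classes: $\alpha$ is $\mathcal{K}$ if continuous, strictly increasing, $\alpha(0)=0$; $\mathcal{K}_\infty$ if moreover unbounded; $\beta$ is $\mathcal{KL}$ if $\beta(\cdot,t)\in\mathcal{K}$ for each $t$ and $\beta(s,\cdot)$ decreases to $0$. *)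

theory Defs
  imports "HOL-Analysis.Analysis" "Jordan_Normal_Form.Spectral_Radius"
begin

(* Gates of an LSTM cell: forget, input, cell (candidate), output *)
datatype gate = Fg | Ig | Cg | Og

(* LSTM parameters.  Layers are indexed l = 1..L.
   lstm_W1 g   : W^{(1)}_g, an n_c x n_x matrix (input layer)
   lstm_W l g  : W^{(l)}_g for l >= 2, an n_c x n_c matrix
   lstm_U l g  : U^{(l)}_g, an n_c x n_c matrix
   lstm_b l g  : b^{(l)}_g in R^{n_c}
   'x indexes R^{n_x}, 'c indexes R^{n_c}. *)
record ('x, 'c) lstm =
  lstm_W1 :: "gate \<Rightarrow> real^'x^'c"
  lstm_W  :: "nat \<Rightarrow> gate \<Rightarrow> real^'c^'c"
  lstm_U  :: "nat \<Rightarrow> gate \<Rightarrow> real^'c^'c"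
  lstm_b  :: "nat \<Rightarrow> gate \<Rightarrow> real^'c"

definition sigmoid :: "real \<Rightarrow> real" where
  "sigmoid w = 1 / (1 + exp (- w))"

definition vsig :: "real^'c \<Rightarrow> real^'c" where
  "vsig v = (\<chi> i. sigmoid (v $ i))"

definition vtanh :: "real^'c \<Rightarrow> real^'c" where
  "vtanh v = (\<chi> i. tanh (v $ i))"

definition hadamard :: "real^'c \<Rightarrow> real^'c \<Rightarrow> real^'c" where
  "hadamard u v = (\<chi> i. u $ i * v $ i)"

(* one LSTM cell update of layer l; wx g = W^{(l)}_g x^{(l)}(t); state (c,h) *)
definition cell :: "('x::finite, 'c::finite) lstm \<Rightarrow> nat \<Rightarrow> (gate \<Rightarrow> real^'c)
    \<Rightarrow> (real^'c) \<times> (real^'c) \<Rightarrow> (real^'c) \<times> (real^'c)" where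
  "cell P l wx s =
     (let c = fst s; h = snd s;
          pre = (\<lambda>g. wx g + lstm_U P l g *v h + lstm_b P l g);
          c' = hadamard (vsig (pre Fg)) c + hadamard (vsig (pre Ig)) (vtanh (pre Cg));
          h' = hadamard (vsig (pre Og)) (vtanh c')
      in (c', h'))"

(* Full state: layer index \<Rightarrow> (c^{(l)}, h^{(l)}) (index 0 unused).
   new_state P xt S l computes s^{(l)}(t+1) from S = s(t) and xt = x(t),
   with x^{(1)}(t) = x(t), x^{(l)}(t) = h^{(l-1)}(t+1). *)
primrec new_state :: "('x::finite, 'c::finite) lstm \<Rightarrow> real^'x
    \<Rightarrow> (nat \<Rightarrow> (real^'c) \<times> (real^'c)) \<Rightarrow> nat \<Rightarrow> (real^'c) \<times> (real^'c)" where
  "new_state P xt S 0 = S 0"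
| "new_state P xt S (Suc l) =
     cell P (Suc l)
       (if l = 0 then (\<lambda>g. lstm_W1 P g *v xt)
        else (\<lambda>g. lstm_W P (Suc l) g *v snd (new_state P xt S l)))
       (S (Suc l))"

(* trajectory s(t) from initial state s0 under input sequence x *)
primrec traj :: "('x::finite, 'c::finite) lstm \<Rightarrow> (nat \<Rightarrow> (real^'c) \<times> (real^'c))
    \<Rightarrow> (nat \<Rightarrow> real^'x) \<Rightarrow> nat \<Rightarrow> (nat \<Rightarrow> (real^'c) \<times> (real^'c))" where
  "traj P s0 x 0 = s0"
| "traj P s0 x (Suc t) = new_state P (x t) (traj P s0 x t)"

(* Euclidean norm of the stacked state s = (s^{(1)},...,s^{(L)}) *)
definition state_norm :: "nat \<Rightarrow> (nat \<Rightarrow> (real^'c) \<times> (real^'c)) \<Rightarrow> real" where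
  "state_norm L S = sqrt (\<Sum>l=1..L. (norm (fst (S l)))\<^sup>2 + (norm (snd (S l)))\<^sup>2)"

(* Euclidean norm of u(t) = (x(t), b_c^{(1)}, ..., b_c^{(L)}) *)
definition input_norm :: "('x::finite, 'c::finite) lstm \<Rightarrow> nat \<Rightarrow> real^'x \<Rightarrow> real" where
  "input_norm P L xt = sqrt ((norm xt)\<^sup>2 + (\<Sum>l=1..L. (norm (lstm_b P l Cg))\<^sup>2))"

(* \<parallel>u(0:t)\<parallel>_{2,\<infinity>} *)
definition input_sup_norm :: "('x::finite, 'c::finite) lstm \<Rightarrow> nat \<Rightarrow> (nat \<Rightarrow> real^'x) \<Rightarrow> nat \<Rightarrow> real" where
  "input_sup_norm P L x t = Max ((\<lambda>\<tau>. input_norm P L (x \<tau>)) ` {0..t})"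

(* sum_j |M_ij|, i.e. the i-th entry of |M| 1 *)
definition abs_row_sum :: "real^'n::finite^'m \<Rightarrow> 'm \<Rightarrow> real" where
  "abs_row_sum M i = (\<Sum>j\<in>UNIV. \<bar>M $ i $ j\<bar>)"

(* i-th entry of x^{(l)}_max |W^{(l)}_g| 1 *)
definition Wterm :: "('x::finite, 'c::finite) lstm \<Rightarrow> real \<Rightarrow> nat \<Rightarrow> gate \<Rightarrow> 'c \<Rightarrow> real" where
  "Wterm P xmax l g i =
     (if l = 1 then xmax * abs_row_sum (lstm_W1 P g) i else 1 * abs_row_sum (lstm_W P l g) i)"

(* G^{(l)}_g(\<eta>) *)
definition Gfun :: "('x::finite, 'c::finite) lstm \<Rightarrow> real \<Rightarrow> nat \<Rightarrow> gate \<Rightarrow> real \<Rightarrow> real" where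
  "Gfun P xmax l g \<eta> =
     (if g = Cg then
        infnorm (\<chi> i. Wterm P xmax l Cg i + \<eta> * abs_row_sum (lstm_U P l Cg) i + \<bar>lstm_b P l Cg $ i\<bar>)
      else
        infnorm (\<chi> i. max 0 (Wterm P xmax l g i + \<eta> * abs_row_sum (lstm_U P l g) i + lstm_b P l g $ i)))"

definition sig_of :: "('x::finite, 'c::finite) lstm \<Rightarrow> real \<Rightarrow> nat \<Rightarrow> gate \<Rightarrow> real \<Rightarrow> real" where
  "sig_of P xmax l g \<eta> = sigmoid (Gfun P xmax l g \<eta>)"

definition cbar_of :: "('x::finite, 'c::finite) lstm \<Rightarrow> real \<Rightarrow> nat \<Rightarrow> real \<Rightarrow> real" where
  "cbar_of P xmax l \<eta> =
     sig_of P xmax l Ig \<eta> * tanh (Gfun P xmax l Cg \<eta>) / (1 - sig_of P xmax l Fg \<eta>)"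

(* eta_prev P xmax l k = \<eta>^{(l)}(k-1), with \<eta>^{(l)}(-1) = 1 *)
primrec eta_prev :: "('x::finite, 'c::finite) lstm \<Rightarrow> real \<Rightarrow> nat \<Rightarrow> nat \<Rightarrow> real" where
  "eta_prev P xmax l 0 = 1"
| "eta_prev P xmax l (Suc k) =
     tanh (cbar_of P xmax l (eta_prev P xmax l k)) * sig_of P xmax l Og (eta_prev P xmax l k)"

(* \<overline>\<sigma>^{(l)}_g(k) *)
definition sigbar :: "('x::finite, 'c::finite) lstm \<Rightarrow> real \<Rightarrow> nat \<Rightarrow> gate \<Rightarrow> nat \<Rightarrow> real" where
  "sigbar P xmax l g k = sig_of P xmax l g (eta_prev P xmax l k)"

(* \<overline>c^{(l)}(k) *)
definition cbar :: "('x::finite, 'c::finite) lstm \<Rightarrow> real \<Rightarrow> nat \<Rightarrow> nat \<Rightarrow> real" where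
  "cbar P xmax l k = cbar_of P xmax l (eta_prev P xmax l k)"

(* \<S>^{(l)}(k) *)
definition Sset :: "('x::finite, 'c::finite) lstm \<Rightarrow> real \<Rightarrow> nat \<Rightarrow> nat \<Rightarrow> ((real^'c) \<times> (real^'c)) set" where
  "Sset P xmax l k = {(c, h). infnorm c \<le> cbar P xmax l k \<and>
                              infnorm h \<le> tanh (cbar P xmax l k) * sigbar P xmax l Og k}"

(* the 2x2 matrix A^{(l)}(k); \<parallel>U_c\<parallel> is the induced 2-norm *)
definition Amat :: "('x::finite, 'c::finite) lstm \<Rightarrow> real \<Rightarrow> nat \<Rightarrow> nat \<Rightarrow> complex Matrix.mat" where
  "Amat P xmax l k =
     (let sf = sigbar P xmax l Fg k; si = sigbar P xmax l Ig k; so = sigbar P xmax l Og k;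
          nU = onorm (\<lambda>v. lstm_U P l Cg *v v)
      in map_mat complex_of_real
           (mat_of_rows_list 2 [[sf, si * nU], [so * sf, so * si * nU]]))"

(* comparison function classes on [0, \<infinity>); KL functions have discrete time argument *)
definition classK :: "(real \<Rightarrow> real) \<Rightarrow> bool" where
  "classK \<alpha> \<longleftrightarrow> continuous_on {0..} \<alpha> \<and> strict_mono_on {0..} \<alpha> \<and> \<alpha> 0 = 0"

definition classKinf :: "(real \<Rightarrow> real) \<Rightarrow> bool" where
  "classKinf \<alpha> \<longleftrightarrow> classK \<alpha> \<and> (\<forall>M. \<exists>s\<ge>0. \<alpha> s > M)"

definition classKL :: "(real \<Rightarrow> nat \<Rightarrow> real) \<Rightarrow> bool" where
  "classKL \<beta> \<longleftrightarrow> (\<forall>t. classK (\<lambda>s. \<beta> s t)) \<and>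
     (\<forall>s\<ge>0. antimono (\<beta> s) \<and> (\<beta> s \<longlonglongrightarrow> 0))"

end

theory Submission
  imports Defs
begin

(* On S(k) every gate of layer l stays below the constant sigbar(k), because the hidden state is
   bounded by eta(k) <= eta(k - 1); the cell box is invariant since cbar(k) is the fixed point of
   C = sigma_f C + sigma_i tanh G_c. In the weighted norm m = max (|c|, |h| / sigma_o) one update
   of layer l then gives
     m(t + 1) <= rho m(t) + sigma_i (|W_c| |input(t)| + |b_c|),
   rho = sigma_f + sigma_o sigma_i |U_c|, and rho is the spectral radius of the rank-one matrix
   A(k) = (1, sigma_o)^T (sigma_f, sigma_i |U_c|). Fixing mu strictly between max_l rho and 1,
   this recursion yields m(t) <= K mu^t |s(0)| + G |u|; the input of layer l + 1 is the hidden
   state of layer l, so these estimates cascade from the bottom layer upwards. Finally eta(k)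
   decreases in k and every gate bound is monotone in eta, so rho(A(k)) decreases in k. *)

(* Frees $ for the components of Finite_Cartesian_Product vectors; vectors of
   Jordan_Normal_Form are accessed with vec_index. *)
no_notation Matrix.vec_index (infixl "$" 100)

lemma outer_product_mult_mat_vec:
  fixes u v w :: "'a::comm_semiring_0 vec"
  assumes "w \<in> carrier_vec n"
  shows "Matrix.mat (dim_vec u) n (\<lambda>(i, j). vec_index u i * vec_index v j) *\<^sub>v w
    = scalar_prod v w \<cdot>\<^sub>v u"
  using assms by (intro eq_vecI) (auto simp: scalar_prod_def sum_distrib_left ac_simps)

lemma spectral_radius_outer_product:
  fixes u v :: "complex vec"
  assumes u: "u \<in> carrier_vec n" "u \<noteq> 0\<^sub>v n" and v: "v \<in> carrier_vec n"
  shows "spectral_radius (Matrix.mat n n (\<lambda>(i, j). vec_index u i * vec_index v j))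
    = norm (scalar_prod v u)"
proof -
  define M where "M = Matrix.mat n n (\<lambda>(i, j). vec_index u i * vec_index v j)"
  have M: "M \<in> carrier_mat n n" by (simp add: M_def)
  have M_mult: "M *\<^sub>v w = scalar_prod v w \<cdot>\<^sub>v u" if "w \<in> carrier_vec n" for w
    using outer_product_mult_mat_vec[OF that, of u v] u by (simp add: M_def)
  have "eigenvector M u (scalar_prod v u)"
    using u M by (simp add: eigenvector_def M_mult)
  then have in_spectrum: "scalar_prod v u \<in> spectrum M"
    by (auto simp: spectrum_def eigenvalue_def)
  have spectrum_cases: "e = 0 \<or> e = scalar_prod v u" if "e \<in> spectrum M" for e
  proof -
    obtain w where "eigenvector M w e"
      using \<open>e \<in> spectrum M\<close> by (auto simp: spectrum_def eigenvalue_def)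
    then have w: "w \<in> carrier_vec n" "w \<noteq> 0\<^sub>v n" "scalar_prod v w \<cdot>\<^sub>v u = e \<cdot>\<^sub>v w"
      using M M_mult by (auto simp: eigenvector_def)
    have "scalar_prod v w * scalar_prod v u = e * scalar_prod v w"
      using arg_cong[OF w(3), of "scalar_prod v"]
      by (simp only: scalar_prod_smult_distrib[OF v u(1)] scalar_prod_smult_distrib[OF v w(1)])
    moreover have "e = 0" if "scalar_prod v w = 0"
    proof (rule ccontr)
      assume "e \<noteq> 0"
      have "e * vec_index w i = 0" if "i < n" for i
        using arg_cong[OF w(3), of "\<lambda>y. vec_index y i"] \<open>scalar_prod v w = 0\<close> u w that by simp
      then have "w = 0\<^sub>v n" using \<open>e \<noteq> 0\<close> w(1) by (intro eq_vecI) auto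
      with w(2) show False ..
    qed
    ultimately show ?thesis by (metis mult.commute mult_cancel_left)
  qed
  then have "norm ` spectrum M \<subseteq> {0, norm (scalar_prod v u)}" by fastforce
  then show ?thesis
    using in_spectrum card_finite_spectrum(1)[OF M]
    unfolding spectral_radius_def M_def[symmetric]
    by (intro Max_eqI) auto
qed

lemma spectral_radius_rank_one_2x2:
  fixes a b s :: real
  assumes "0 \<le> a" "0 \<le> b" "0 \<le> s"
  shows "spectral_radius (map_mat complex_of_real (mat_of_rows_list 2 [[a, b], [s * a, s * b]]))
    = a + s * b"
proof -
  let ?u = "vec_of_list [1, complex_of_real s]" and ?v = "vec_of_list [complex_of_real a, of_real b]"
  have "vec_index ?u 0 = 1" by (simp only: vec_of_list_index nth_Cons_0)
  then have u0: "?u \<noteq> 0\<^sub>v 2" by (metis index_zero_vec(1) pos2 zero_neq_one)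
  have u_carrier: "?u \<in> carrier_vec 2" and v_carrier: "?v \<in> carrier_vec 2"
    by (rule carrier_vecI, subst dim_vec_of_list, simp)+
  have "map_mat complex_of_real (mat_of_rows_list 2 [[a, b], [s * a, s * b]])
      = Matrix.mat 2 2 (\<lambda>(i, j). vec_index ?u i * vec_index ?v j)"
    by (rule eq_matI) (auto simp: mat_of_rows_list_def less_2_cases_iff)
  also have "spectral_radius \<dots> = norm (scalar_prod ?v ?u)"
    by (rule spectral_radius_outer_product[OF u_carrier u0 v_carrier])
  also have "scalar_prod ?v ?u = of_real (a + s * b)"
    by (simp add: scalar_prod_def numeral_2_eq_2 ac_simps)
  also have "norm (complex_of_real (a + s * b)) = a + s * b"
    using assms by (simp only: norm_of_real abs_of_nonneg add_nonneg_nonneg mult_nonneg_nonneg)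
  finally show ?thesis .
qed

lemma sigmoid_pos: "0 < sigmoid w"
  unfolding sigmoid_def by (simp add: add_pos_pos)

lemma sigmoid_less_1: "sigmoid w < 1"
  unfolding sigmoid_def by (simp add: add_pos_pos field_simps)

lemma sigmoid_mono: "w \<le> w' \<Longrightarrow> sigmoid w \<le> sigmoid w'"
  unfolding sigmoid_def by (intro divide_left_mono) (auto simp: add_pos_pos)

lemma tanh_le_self:
  assumes "0 \<le> x"
  shows "tanh x \<le> (x::real)"
proof -
  have "(\<lambda>y. y - tanh y) 0 \<le> (\<lambda>y. y - tanh y) x"
  proof (rule DERIV_nonneg_imp_increasing_open[OF assms])
    fix y :: real
    have "((\<lambda>y. y - tanh y) has_real_derivative 1 - (1 - tanh y ^ 2)) (at y)"
      by (intro derivative_eq_intros) auto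
    then show "\<exists>d. ((\<lambda>y. y - tanh y) has_real_derivative d) (at y) \<and> 0 \<le> d" by force
  qed (intro continuous_intros, auto)
  then show ?thesis by simp
qed

lemma abs_tanh_le_abs: "\<bar>tanh x\<bar> \<le> \<bar>x::real\<bar>"
  using tanh_le_self[of "\<bar>x\<bar>"] by simp

lemma abs_tanh_le_1: "\<bar>tanh (x::real)\<bar> \<le> 1"
  using tanh_real_bounds[of x] by auto

lemma infnorm_le_iff_cart: "infnorm (x::real^'n) \<le> B \<longleftrightarrow> (\<forall>i. \<bar>x$i\<bar> \<le> B)"
proof
  assume "\<forall>i. \<bar>x$i\<bar> \<le> B"
  then show "infnorm x \<le> B" unfolding infnorm_cart by (intro cSup_least) auto
qed (use component_le_infnorm_cart order_trans in blast)

lemma norm_hadamard_le: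
  assumes "\<forall>i. \<bar>u$i\<bar> \<le> B"
  shows "norm (hadamard u v) \<le> B * norm v"
proof -
  have B: "0 \<le> B" using assms[rule_format, of undefined] by linarith
  have "norm (hadamard u v) \<le> norm (B *\<^sub>R v)"
  proof (rule norm_le_componentwise_cart)
    fix i
    have "\<bar>u$i\<bar> * \<bar>v$i\<bar> \<le> B * \<bar>v$i\<bar>" using assms by (intro mult_right_mono) auto
    then show "norm (hadamard u v $ i) \<le> norm ((B *\<^sub>R v) $ i)"
      using B by (simp add: hadamard_def abs_mult)
  qed
  then show ?thesis using B by simp
qed

lemma norm_vtanh_le: "norm (vtanh v) \<le> norm v"
  by (rule norm_le_componentwise_cart) (simp add: vtanh_def abs_tanh_le_abs)

lemma abs_row_sum_nonneg: "0 \<le> abs_row_sum M i"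
  unfolding abs_row_sum_def by (simp add: sum_nonneg)

lemma abs_matrix_vector_mult_le:
  assumes "\<forall>j. \<bar>x$j\<bar> \<le> B"
  shows "\<bar>(M *v x)$i\<bar> \<le> B * abs_row_sum M i"
proof -
  have "\<bar>(M *v x)$i\<bar> = \<bar>\<Sum>j\<in>UNIV. M$i$j * x$j\<bar>"
    by (simp add: matrix_vector_mult_def)
  also have "\<dots> \<le> (\<Sum>j\<in>UNIV. \<bar>M$i$j\<bar> * \<bar>x$j\<bar>)"
    unfolding abs_mult[symmetric] by (rule sum_abs)
  also have "\<dots> \<le> (\<Sum>j\<in>UNIV. \<bar>M$i$j\<bar> * B)"
    using assms by (intro sum_mono mult_left_mono) auto
  also have "\<dots> = B * abs_row_sum M i"
    by (simp add: abs_row_sum_def sum_distrib_left mult.commute)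
  finally show ?thesis .
qed

lemma Wterm_nonneg: "0 \<le> xmax \<Longrightarrow> 0 \<le> Wterm P xmax l g i"
  unfolding Wterm_def by (auto intro!: mult_nonneg_nonneg abs_row_sum_nonneg)

lemma Gfun_nonneg: "0 \<le> Gfun P xmax l g \<eta>"
  unfolding Gfun_def by (simp add: infnorm_pos_le)

lemma Gfun_mono:
  assumes "0 \<le> xmax" "0 \<le> \<eta>" "\<eta> \<le> \<eta>'"
  shows "Gfun P xmax l g \<eta> \<le> Gfun P xmax l g \<eta>'"
proof -
  have U: "\<eta> * abs_row_sum M i \<le> \<eta>' * abs_row_sum M i" "0 \<le> \<eta> * abs_row_sum M i"
    for M :: "real^'c^'c" and i
    using assms(2,3) abs_row_sum_nonneg[of M i] by (simp_all add: mult_right_mono)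
  have infnorm_mono: "infnorm u \<le> infnorm v" if "\<forall>i. \<bar>u$i\<bar> \<le> \<bar>v$i\<bar>" for u v :: "real^'c"
    unfolding infnorm_le_iff_cart using that component_le_infnorm_cart order_trans by blast
  show ?thesis
  proof (cases "g = Cg")
    case True
    have "\<bar>Wterm P xmax l Cg i + \<eta> * abs_row_sum (lstm_U P l Cg) i + \<bar>lstm_b P l Cg $ i\<bar>\<bar>
        \<le> \<bar>Wterm P xmax l Cg i + \<eta>' * abs_row_sum (lstm_U P l Cg) i + \<bar>lstm_b P l Cg $ i\<bar>\<bar>" for i
      using U[of "lstm_U P l Cg" i] Wterm_nonneg[OF assms(1), of P l Cg i] abs_ge_zero[of "lstm_b P l Cg $ i"]
      by (smt (verit))
    then show ?thesis
      unfolding Gfun_def using True by (auto intro!: infnorm_mono)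
  next
    case False
    have "\<bar>max 0 (Wterm P xmax l g i + \<eta> * abs_row_sum (lstm_U P l g) i + lstm_b P l g $ i)\<bar>
        \<le> \<bar>max 0 (Wterm P xmax l g i + \<eta>' * abs_row_sum (lstm_U P l g) i + lstm_b P l g $ i)\<bar>" for i
      using U[of "lstm_U P l g" i] by auto
    then show ?thesis
      unfolding Gfun_def using False by (auto intro!: infnorm_mono)
  qed
qed

lemma sig_of_pos: "0 < sig_of P xmax l g \<eta>"
  and sig_of_less_1: "sig_of P xmax l g \<eta> < 1"
  unfolding sig_of_def by (rule sigmoid_pos, rule sigmoid_less_1)

lemma sigbar_pos: "0 < sigbar P xmax l g k"
  and sigbar_less_1: "sigbar P xmax l g k < 1"
  unfolding sigbar_def by (rule sig_of_pos, rule sig_of_less_1)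

lemma sig_of_mono:
  "0 \<le> xmax \<Longrightarrow> 0 \<le> \<eta> \<Longrightarrow> \<eta> \<le> \<eta>' \<Longrightarrow> sig_of P xmax l g \<eta> \<le> sig_of P xmax l g \<eta>'"
  unfolding sig_of_def by (intro sigmoid_mono Gfun_mono)

lemma cbar_of_nonneg: "0 \<le> cbar_of P xmax l \<eta>"
  unfolding cbar_of_def
  using sig_of_pos[of P xmax l Ig \<eta>] sig_of_less_1[of P xmax l Fg \<eta>] Gfun_nonneg[of P xmax l Cg \<eta>]
  by simp

lemma cbar_of_mono:
  assumes "0 \<le> xmax" "0 \<le> \<eta>" "\<eta> \<le> \<eta>'"
  shows "cbar_of P xmax l \<eta> \<le> cbar_of P xmax l \<eta>'"
proof -
  have num: "sig_of P xmax l Ig \<eta> * tanh (Gfun P xmax l Cg \<eta>)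
      \<le> sig_of P xmax l Ig \<eta>' * tanh (Gfun P xmax l Cg \<eta>')"
    using sig_of_mono[OF assms] Gfun_mono[OF assms] less_imp_le[OF sig_of_pos] Gfun_nonneg
    by (intro mult_mono) auto
  have "0 \<le> sig_of P xmax l Ig \<eta>' * tanh (Gfun P xmax l Cg \<eta>')"
    using sig_of_pos[of P xmax l Ig \<eta>'] Gfun_nonneg[of P xmax l Cg \<eta>'] by simp
  then show ?thesis
    unfolding cbar_of_def
    using sig_of_mono[OF assms, of P l Fg] sig_of_less_1[of P xmax l Fg \<eta>']
    by (intro frac_le[OF _ num]) auto
qed

lemma eta_prev_nonneg: "0 \<le> eta_prev P xmax l k"
  by (cases k) (auto intro!: mult_nonneg_nonneg less_imp_le[OF sig_of_pos] simp: cbar_of_nonneg)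

lemma eta_prev_Suc_le:
  assumes "0 \<le> xmax"
  shows "eta_prev P xmax l (Suc k) \<le> eta_prev P xmax l k"
proof (induction k)
  case 0
  have "tanh (cbar_of P xmax l 1) * sig_of P xmax l Og 1 \<le> 1 * 1"
    using abs_tanh_le_1[of "cbar_of P xmax l 1"] sig_of_less_1[of P xmax l Og 1]
      sig_of_pos[of P xmax l Og 1] cbar_of_nonneg[of P xmax l 1]
    by (intro mult_mono) auto
  then show ?case by simp
next
  case (Suc k)
  let ?e = "eta_prev P xmax l"
  have "tanh (cbar_of P xmax l (?e (Suc k))) * sig_of P xmax l Og (?e (Suc k))
      \<le> tanh (cbar_of P xmax l (?e k)) * sig_of P xmax l Og (?e k)"
    using cbar_of_mono[OF assms eta_prev_nonneg Suc.IH] sig_of_mono[OF assms eta_prev_nonneg Suc.IH]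
      cbar_of_nonneg sig_of_pos[of P xmax l Og "?e (Suc k)"]
    by (intro mult_mono) auto
  then show ?case by simp
qed

definition preact :: "('x::finite, 'c::finite) lstm \<Rightarrow> nat \<Rightarrow> (gate \<Rightarrow> real^'c) \<Rightarrow> real^'c
    \<Rightarrow> gate \<Rightarrow> real^'c" where
  "preact P l wx h g = wx g + lstm_U P l g *v h + lstm_b P l g"

lemma cell_fst: "fst (cell P l wx s) =
    hadamard (vsig (preact P l wx (snd s) Fg)) (fst s)
    + hadamard (vsig (preact P l wx (snd s) Ig)) (vtanh (preact P l wx (snd s) Cg))"
  by (simp add: cell_def Let_def preact_def)

lemma cell_snd: "snd (cell P l wx s) = hadamard (vsig (preact P l wx (snd s) Og)) (vtanh (fst (cell P l wx s)))"
  by (simp add: cell_def Let_def preact_def)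

lemma preact_le_Gfun:
  assumes "\<forall>g i. \<bar>wx g $ i\<bar> \<le> Wterm P xmax l g i" and "infnorm h \<le> \<eta>"
  shows "g \<noteq> Cg \<Longrightarrow> preact P l wx h g $ i \<le> Gfun P xmax l g \<eta>"
    and "\<bar>preact P l wx h Cg $ i\<bar> \<le> Gfun P xmax l Cg \<eta>"
proof -
  have "\<bar>(lstm_U P l g' *v h)$i\<bar> \<le> \<eta> * abs_row_sum (lstm_U P l g') i" for g'
    using assms(2) by (intro abs_matrix_vector_mult_le) (simp add: infnorm_le_iff_cart)
  then have bound: "\<bar>preact P l wx h g' $ i - lstm_b P l g' $ i\<bar>
      \<le> Wterm P xmax l g' i + \<eta> * abs_row_sum (lstm_U P l g') i" for g'
    using assms(1) by (smt (verit) preact_def vector_add_component)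
  show "preact P l wx h g $ i \<le> Gfun P xmax l g \<eta>" if "g \<noteq> Cg"
  proof -
    let ?v = "\<chi> i. max 0 (Wterm P xmax l g i + \<eta> * abs_row_sum (lstm_U P l g) i + lstm_b P l g $ i)"
    have "preact P l wx h g $ i \<le> \<bar>?v $ i\<bar>" using bound[of g] by simp
    also have "\<dots> \<le> infnorm ?v" by (rule component_le_infnorm_cart)
    finally show ?thesis using that by (simp add: Gfun_def)
  qed
  let ?v = "\<chi> i. Wterm P xmax l Cg i + \<eta> * abs_row_sum (lstm_U P l Cg) i + \<bar>lstm_b P l Cg $ i\<bar>"
  have "\<bar>preact P l wx h Cg $ i\<bar> \<le> \<bar>?v $ i\<bar>" using bound[of Cg] by simp
  also have "\<dots> \<le> infnorm ?v" by (rule component_le_infnorm_cart)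
  also have "infnorm ?v = Gfun P xmax l Cg \<eta>" by (simp add: Gfun_def)
  finally show "\<bar>preact P l wx h Cg $ i\<bar> \<le> Gfun P xmax l Cg \<eta>" .
qed

lemma vsig_preact_le:
  assumes "\<forall>g i. \<bar>wx g $ i\<bar> \<le> Wterm P xmax l g i" "infnorm h \<le> \<eta>" "g \<noteq> Cg"
  shows "\<bar>vsig (preact P l wx h g) $ i\<bar> \<le> sig_of P xmax l g \<eta>"
  using sigmoid_pos[of "preact P l wx h g $ i"] sigmoid_mono[OF preact_le_Gfun(1)[OF assms]]
  by (simp add: vsig_def sig_of_def)

lemma vtanh_preact_le:
  assumes "\<forall>g i. \<bar>wx g $ i\<bar> \<le> Wterm P xmax l g i" "infnorm h \<le> \<eta>"
  shows "\<bar>vtanh (preact P l wx h Cg) $ i\<bar> \<le> tanh (Gfun P xmax l Cg \<eta>)"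
  using preact_le_Gfun(2)[OF assms] by (simp add: vtanh_def flip: tanh_real_abs)

(* The box bound on the cell state is invariant because cbar_of is the fixed point of
   C = sig_f * C + sig_i * tanh G_c. *)
lemma cell_infnorm_le:
  assumes wx: "\<forall>g i. \<bar>wx g $ i\<bar> \<le> Wterm P xmax l g i"
    and h: "infnorm (snd s) \<le> \<eta>" and c: "infnorm (fst s) \<le> cbar_of P xmax l \<eta>"
  shows "infnorm (fst (cell P l wx s)) \<le> cbar_of P xmax l \<eta>"
    and "infnorm (snd (cell P l wx s)) \<le> tanh (cbar_of P xmax l \<eta>) * sig_of P xmax l Og \<eta>"
proof -
  define sf si so T C where "sf = sig_of P xmax l Fg \<eta>" and "si = sig_of P xmax l Ig \<eta>"
    and "so = sig_of P xmax l Og \<eta>" and "T = tanh (Gfun P xmax l Cg \<eta>)" and "C = cbar_of P xmax l \<eta>"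
  have fixed_point: "sf * C + si * T = C"
    using sig_of_less_1[of P xmax l Fg \<eta>]
    unfolding C_def cbar_of_def sf_def[symmetric] si_def[symmetric] T_def[symmetric]
    by (simp add: field_simps)
  let ?pre = "preact P l wx (snd s)"
  have c': "\<bar>fst (cell P l wx s) $ i\<bar> \<le> C" for i
  proof -
    have "\<bar>fst (cell P l wx s) $ i\<bar>
        \<le> \<bar>vsig (?pre Fg) $ i\<bar> * \<bar>fst s $ i\<bar> + \<bar>vsig (?pre Ig) $ i\<bar> * \<bar>vtanh (?pre Cg) $ i\<bar>"
      unfolding cell_fst by (simp add: hadamard_def abs_mult[symmetric] abs_triangle_ineq)
    also have "\<dots> \<le> sf * C + si * T"
      unfolding sf_def si_def T_def
      using vsig_preact_le[OF wx h] vtanh_preact_le[OF wx h] c less_imp_le[OF sig_of_pos]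
      by (intro add_mono mult_mono) (auto simp: C_def infnorm_le_iff_cart)
    finally show ?thesis using fixed_point by simp
  qed
  then show "infnorm (fst (cell P l wx s)) \<le> cbar_of P xmax l \<eta>"
    unfolding infnorm_le_iff_cart C_def by blast
  have "\<bar>snd (cell P l wx s) $ i\<bar> \<le> tanh C * so" for i
  proof -
    have "\<bar>snd (cell P l wx s) $ i\<bar> = \<bar>vsig (?pre Og) $ i\<bar> * tanh \<bar>fst (cell P l wx s) $ i\<bar>"
      unfolding cell_snd by (simp add: hadamard_def vtanh_def abs_mult)
    also have "\<dots> \<le> so * tanh C"
      unfolding so_def using vsig_preact_le[OF wx h] c'[of i] less_imp_le[OF sig_of_pos]
      by (intro mult_mono) (auto simp only: tanh_real_le_iff tanh_real_nonneg_iff abs_ge_zero)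
    finally show ?thesis by (simp add: mult.commute)
  qed
  then show "infnorm (snd (cell P l wx s)) \<le> tanh (cbar_of P xmax l \<eta>) * sig_of P xmax l Og \<eta>"
    unfolding infnorm_le_iff_cart C_def so_def by blast
qed

lemma cell_norm_le:
  assumes wx: "\<forall>g i. \<bar>wx g $ i\<bar> \<le> Wterm P xmax l g i" and h: "infnorm (snd s) \<le> \<eta>"
  shows "norm (fst (cell P l wx s)) \<le> sig_of P xmax l Fg \<eta> * norm (fst s)
      + sig_of P xmax l Ig \<eta> * (norm (wx Cg) + onorm ((*v) (lstm_U P l Cg)) * norm (snd s)
        + norm (lstm_b P l Cg))"
    and "norm (snd (cell P l wx s)) \<le> sig_of P xmax l Og \<eta> * norm (fst (cell P l wx s))"
proof -
  let ?pre = "preact P l wx (snd s)"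
  have "norm (?pre Cg) \<le> norm (wx Cg) + norm (lstm_U P l Cg *v snd s) + norm (lstm_b P l Cg)"
    unfolding preact_def
    using norm_triangle_ineq[of "wx Cg + lstm_U P l Cg *v snd s" "lstm_b P l Cg"]
      norm_triangle_ineq[of "wx Cg" "lstm_U P l Cg *v snd s"]
    by linarith
  moreover have "norm (lstm_U P l Cg *v snd s) \<le> onorm ((*v) (lstm_U P l Cg)) * norm (snd s)"
    by (rule onorm[OF matrix_vector_mul_bounded_linear])
  ultimately have pre_c: "norm (?pre Cg)
      \<le> norm (wx Cg) + onorm ((*v) (lstm_U P l Cg)) * norm (snd s) + norm (lstm_b P l Cg)"
    by linarith
  have "norm (fst (cell P l wx s))
      \<le> norm (hadamard (vsig (?pre Fg)) (fst s)) + norm (hadamard (vsig (?pre Ig)) (vtanh (?pre Cg)))"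
    unfolding cell_fst by (rule norm_triangle_ineq)
  also have "\<dots> \<le> sig_of P xmax l Fg \<eta> * norm (fst s) + sig_of P xmax l Ig \<eta> * norm (vtanh (?pre Cg))"
    by (intro add_mono norm_hadamard_le allI vsig_preact_le[OF wx h]) auto
  also have "\<dots> \<le> sig_of P xmax l Fg \<eta> * norm (fst s)
      + sig_of P xmax l Ig \<eta> * (norm (wx Cg) + onorm ((*v) (lstm_U P l Cg)) * norm (snd s)
        + norm (lstm_b P l Cg))"
    using order_trans[OF norm_vtanh_le pre_c] sig_of_pos[of P xmax l Ig \<eta>]
    by (intro add_left_mono mult_left_mono) auto
  finally show "norm (fst (cell P l wx s)) \<le> sig_of P xmax l Fg \<eta> * norm (fst s)
      + sig_of P xmax l Ig \<eta> * (norm (wx Cg) + onorm ((*v) (lstm_U P l Cg)) * norm (snd s)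
        + norm (lstm_b P l Cg))" .
  have "norm (snd (cell P l wx s)) \<le> sig_of P xmax l Og \<eta> * norm (vtanh (fst (cell P l wx s)))"
    unfolding cell_snd by (intro norm_hadamard_le allI vsig_preact_le[OF wx h]) auto
  also have "\<dots> \<le> sig_of P xmax l Og \<eta> * norm (fst (cell P l wx s))"
    using norm_vtanh_le sig_of_pos[of P xmax l Og \<eta>] by (intro mult_left_mono) auto
  finally show "norm (snd (cell P l wx s)) \<le> sig_of P xmax l Og \<eta> * norm (fst (cell P l wx s))" .
qed

definition layer_input :: "('x::finite, 'c::finite) lstm \<Rightarrow> real^'x \<Rightarrow> (nat \<Rightarrow> (real^'c) \<times> (real^'c))
    \<Rightarrow> nat \<Rightarrow> gate \<Rightarrow> real^'c" where
  "layer_input P xt S l =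
     (if l = 1 then (\<lambda>g. lstm_W1 P g *v xt) else (\<lambda>g. lstm_W P l g *v snd (new_state P xt S (l - 1))))"

definition Wc_norm :: "('x::finite, 'c::finite) lstm \<Rightarrow> nat \<Rightarrow> real" where
  "Wc_norm P l = (if l = 1 then onorm ((*v) (lstm_W1 P Cg)) else onorm ((*v) (lstm_W P l Cg)))"

lemma new_state_eq_cell: "1 \<le> l \<Longrightarrow> new_state P xt S l = cell P l (layer_input P xt S l) (S l)"
  by (cases l) (auto simp: layer_input_def)

lemma abs_snd_new_state_le_1:
  assumes "1 \<le> l"
  shows "\<bar>snd (new_state P xt S l) $ j\<bar> \<le> 1"
proof -
  let ?S' = "new_state P xt S l"
  have "\<bar>snd ?S' $ j\<bar> = \<bar>vsig (preact P l (layer_input P xt S l) (snd (S l)) Og) $ j\<bar> * \<bar>tanh (fst ?S' $ j)\<bar>"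
    unfolding new_state_eq_cell[OF assms] cell_snd by (simp add: hadamard_def vtanh_def abs_mult)
  also have "\<dots> \<le> 1 * 1"
    using sigmoid_pos sigmoid_less_1 abs_tanh_le_1
    by (intro mult_mono) (auto simp: vsig_def less_imp_le)
  finally show ?thesis by simp
qed

lemma abs_layer_input_le_Wterm:
  assumes "0 \<le> xmax" "\<forall>i. \<bar>xt $ i\<bar> \<le> xmax" "1 \<le> l"
  shows "\<forall>g i. \<bar>layer_input P xt S l g $ i\<bar> \<le> Wterm P xmax l g i"
proof (intro allI)
  fix g i
  show "\<bar>layer_input P xt S l g $ i\<bar> \<le> Wterm P xmax l g i"
  proof (cases "l = 1")
    case True
    then show ?thesis
      using abs_matrix_vector_mult_le[OF assms(2)] by (simp add: layer_input_def Wterm_def)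
  next
    case False
    then have "1 \<le> l - 1" using assms(3) by simp
    then have "\<forall>j. \<bar>snd (new_state P xt S (l - 1)) $ j\<bar> \<le> 1"
      using abs_snd_new_state_le_1 by blast
    from abs_matrix_vector_mult_le[OF this, of "lstm_W P l g" i] False
    show ?thesis by (simp add: layer_input_def Wterm_def)
  qed
qed

lemma norm_layer_input_le:
  "norm (layer_input P xt S l Cg)
    \<le> Wc_norm P l * (if l = 1 then norm xt else norm (snd (new_state P xt S (l - 1))))"
  unfolding layer_input_def Wc_norm_def by (simp add: onorm[OF matrix_vector_mul_bounded_linear])

lemma Sset_iff: "s \<in> Sset P xmax l k \<longleftrightarrow>
    infnorm (fst s) \<le> cbar_of P xmax l (eta_prev P xmax l k) \<and> infnorm (snd s) \<le> eta_prev P xmax l (Suc k)"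
  by (cases s) (simp add: Sset_def cbar_def sigbar_def)

definition admissible :: "('x::finite, 'c::finite) lstm \<Rightarrow> real \<Rightarrow> nat \<Rightarrow> nat
    \<Rightarrow> (nat \<Rightarrow> (real^'c) \<times> (real^'c)) \<Rightarrow> (nat \<Rightarrow> real^'x) \<Rightarrow> bool" where
  "admissible P xmax L k s0 x \<longleftrightarrow> (\<forall>l\<in>{1..L}. s0 l \<in> Sset P xmax l k) \<and> (\<forall>\<tau> i. \<bar>x \<tau> $ i\<bar> \<le> xmax)"

(* In S(k) the hidden state is bounded by eta(k) <= eta(k - 1), the bound from which the gate
   ranges sigbar(k) are computed. *)
lemma traj_in_Sset:
  assumes "0 \<le> xmax" "admissible P xmax L k s0 x" "l \<in> {1..L}"
  shows "traj P s0 x t l \<in> Sset P xmax l k"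
  using assms(3)
proof (induction t arbitrary: l)
  case 0
  then show ?case using assms(2) by (simp add: admissible_def)
next
  case (Suc t)
  let ?S = "traj P s0 x t"
  have c: "infnorm (fst (?S l)) \<le> cbar_of P xmax l (eta_prev P xmax l k)"
    and "infnorm (snd (?S l)) \<le> eta_prev P xmax l (Suc k)"
    using Suc Sset_iff by blast+
  then have h: "infnorm (snd (?S l)) \<le> eta_prev P xmax l k"
    using eta_prev_Suc_le[OF assms(1)] order_trans by blast
  have wx: "\<forall>g i. \<bar>layer_input P (x t) ?S l g $ i\<bar> \<le> Wterm P xmax l g i"
    using assms(1,2) Suc.prems by (intro abs_layer_input_le_Wterm) (auto simp: admissible_def)
  have "traj P s0 x (Suc t) l = cell P l (layer_input P (x t) ?S l) (?S l)"
    using new_state_eq_cell[of l P "x t" ?S] Suc.prems by simp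
  then show ?case
    unfolding Sset_iff using cell_infnorm_le[OF wx h c] by simp
qed

definition contraction_rate :: "('x::finite, 'c::finite) lstm \<Rightarrow> real \<Rightarrow> nat \<Rightarrow> nat \<Rightarrow> real" where
  "contraction_rate P xmax l k = sigbar P xmax l Fg k
     + sigbar P xmax l Og k * (sigbar P xmax l Ig k * onorm ((*v) (lstm_U P l Cg)))"

lemma contraction_rate_nonneg: "0 \<le> contraction_rate P xmax l k"
  unfolding contraction_rate_def
  using less_imp_le[OF sigbar_pos, of P xmax l _ k]
    onorm_pos_le[OF matrix_vector_mul_bounded_linear, of "lstm_U P l Cg"]
  by simp

(* Amat is the outer product of (1, sigma_o) and (sigma_f, sigma_i |U_c|). *)
lemma spectral_radius_Amat: "spectral_radius (Amat P xmax l k) = contraction_rate P xmax l k"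
proof -
  let ?f = "sigbar P xmax l Fg k" and ?i = "sigbar P xmax l Ig k" and ?o = "sigbar P xmax l Og k"
    and ?u = "onorm ((*v) (lstm_U P l Cg))"
  have "Amat P xmax l k
      = map_mat complex_of_real (mat_of_rows_list 2 [[?f, ?i * ?u], [?o * ?f, ?o * (?i * ?u)]])"
    unfolding Amat_def Let_def by (simp add: mult.assoc)
  also have "spectral_radius \<dots> = contraction_rate P xmax l k"
    unfolding contraction_rate_def
    using less_imp_le[OF sigbar_pos, of P xmax l _ k]
      onorm_pos_le[OF matrix_vector_mul_bounded_linear, of "lstm_U P l Cg"]
    by (intro spectral_radius_rank_one_2x2) auto
  finally show ?thesis .
qed

lemma contraction_rate_Suc_le:
  assumes "0 \<le> xmax"
  shows "contraction_rate P xmax l (Suc k) \<le> contraction_rate P xmax l k"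
proof -
  have "sigbar P xmax l g (Suc k) \<le> sigbar P xmax l g k" for g
    unfolding sigbar_def by (rule sig_of_mono[OF assms eta_prev_nonneg eta_prev_Suc_le[OF assms]])
  then show ?thesis
    unfolding contraction_rate_def
    using less_imp_le[OF sigbar_pos, of P xmax l _ "Suc k"] less_imp_le[OF sigbar_pos, of P xmax l _ k]
      onorm_pos_le[OF matrix_vector_mul_bounded_linear, of "lstm_U P l Cg"]
    by (intro add_mono mult_mono mult_right_mono) auto
qed

lemma linear_recurrence_le_geometric:
  fixes m :: "nat \<Rightarrow> real"
  assumes r: "0 \<le> r" "r < \<mu>" "\<mu> < 1" and a: "0 \<le> a" and b: "0 \<le> b" and m0: "0 \<le> m 0"
    and step: "\<And>t. t < T \<Longrightarrow> m (Suc t) \<le> r * m t + a * \<mu> ^ t + b"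
  shows "t \<le> T \<Longrightarrow> m t \<le> (m 0 + a / (\<mu> - r)) * \<mu> ^ t + b / (1 - r)"
proof (induction t)
  case 0
  then show ?case using r a b by simp
next
  case (Suc t)
  define D E where "D = m 0 + a / (\<mu> - r)" and "E = b / (1 - r)"
  have D: "r * D + a \<le> \<mu> * D"
  proof -
    have "(\<mu> - r) * D = (\<mu> - r) * m 0 + a" using r by (simp add: D_def distrib_left)
    then have "\<mu> * D - r * D = (\<mu> - r) * m 0 + a" by (simp add: left_diff_distrib)
    moreover have "0 \<le> (\<mu> - r) * m 0" using r m0 by simp
    ultimately show ?thesis by linarith
  qed
  have E: "r * E + b = E" using r by (simp add: E_def field_simps)
  have "m (Suc t) \<le> r * m t + a * \<mu> ^ t + b" using step Suc.prems by simp
  also have "\<dots> \<le> r * (D * \<mu> ^ t + E) + a * \<mu> ^ t + b"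
    using Suc r by (simp add: D_def E_def mult_left_mono)
  also have "\<dots> = (r * D + a) * \<mu> ^ t + (r * E + b)" by (simp add: algebra_simps)
  also have "\<dots> \<le> (\<mu> * D) * \<mu> ^ t + E" using D E r by (simp add: mult_right_mono)
  also have "\<dots> = D * \<mu> ^ Suc t + E" by (simp add: ac_simps)
  finally show ?case unfolding D_def E_def .
qed

lemma state_norm_eq_L2_set: "state_norm L S = L2_set (\<lambda>l. norm (S l)) {1..L}"
  unfolding state_norm_def L2_set_def norm_prod_def by simp

lemma state_norm_nonneg: "0 \<le> state_norm L S"
  by (simp add: state_norm_eq_L2_set)

lemma norm_le_state_norm: "l \<in> {1..L} \<Longrightarrow> norm (S l) \<le> state_norm L S"
  unfolding state_norm_eq_L2_set by (rule member_le_L2_set) auto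

lemma state_norm_le_sum: "state_norm L S \<le> (\<Sum>l=1..L. norm (S l))"
  unfolding state_norm_eq_L2_set by (rule L2_set_le_sum) simp

lemma norm_le_input_norm: "norm xt \<le> input_norm P L xt"
  unfolding input_norm_def by (rule real_le_rsqrt) (simp add: sum_nonneg)

lemma norm_bias_le_input_norm:
  assumes "l \<in> {1..L}"
  shows "norm (lstm_b P l Cg) \<le> input_norm P L xt"
proof -
  have "(norm (lstm_b P l Cg))\<^sup>2 \<le> (\<Sum>l=1..L. (norm (lstm_b P l Cg))\<^sup>2)"
    using assms by (intro member_le_sum) auto
  then show ?thesis
    unfolding input_norm_def by (intro real_le_rsqrt) (simp add: add_increasing)
qed

lemma input_norm_le_input_sup_norm: "\<tau> \<le> T \<Longrightarrow> input_norm P L (x \<tau>) \<le> input_sup_norm P L x T"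
  unfolding input_sup_norm_def by (intro Max_ge) auto

lemma norm_le_input_sup_norm: "\<tau> \<le> T \<Longrightarrow> norm (x \<tau>) \<le> input_sup_norm P L x T"
  using norm_le_input_norm input_norm_le_input_sup_norm order_trans by blast

lemma norm_bias_le_input_sup_norm: "l \<in> {1..L} \<Longrightarrow> norm (lstm_b P l Cg) \<le> input_sup_norm P L x T"
  using norm_bias_le_input_norm[of l L P "x 0"] input_norm_le_input_sup_norm[of 0 T P L x] by simp

lemma input_sup_norm_nonneg: "0 \<le> input_sup_norm P L x T"
  using norm_le_input_sup_norm[of 0 T x P L] norm_ge_zero[of "x 0"] by linarith

(* Weighting by the right Perron vector (1, sigma_o) of A(k) makes the induced norm of A(k) equal
   to its spectral radius, so the layer update becomes a scalar recursion with rate rho(A(k)). *)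
definition layer_norm :: "('x::finite, 'c::finite) lstm \<Rightarrow> real \<Rightarrow> nat \<Rightarrow> (nat \<Rightarrow> (real^'c) \<times> (real^'c))
    \<Rightarrow> (nat \<Rightarrow> real^'x) \<Rightarrow> nat \<Rightarrow> nat \<Rightarrow> real" where
  "layer_norm P xmax k s0 x l t =
     max (norm (fst (traj P s0 x t l))) (norm (snd (traj P s0 x t l)) / sigbar P xmax l Og k)"

definition layer_drive :: "('x::finite, 'c::finite) lstm \<Rightarrow> (nat \<Rightarrow> (real^'c) \<times> (real^'c))
    \<Rightarrow> (nat \<Rightarrow> real^'x) \<Rightarrow> nat \<Rightarrow> nat \<Rightarrow> real" where
  "layer_drive P s0 x l t = (if l = 1 then norm (x t) else norm (snd (traj P s0 x (Suc t) (l - 1))))"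

lemma layer_norm_ge:
  shows "norm (fst (traj P s0 x t l)) \<le> layer_norm P xmax k s0 x l t"
    and "norm (snd (traj P s0 x t l)) \<le> sigbar P xmax l Og k * layer_norm P xmax k s0 x l t"
    and "norm (snd (traj P s0 x t l)) \<le> layer_norm P xmax k s0 x l t"
proof -
  let ?m = "layer_norm P xmax k s0 x l t" and ?o = "sigbar P xmax l Og k"
  show fst: "norm (fst (traj P s0 x t l)) \<le> ?m" by (simp add: layer_norm_def)
  have "norm (snd (traj P s0 x t l)) / ?o \<le> ?m" by (simp add: layer_norm_def)
  then show snd: "norm (snd (traj P s0 x t l)) \<le> ?o * ?m"
    using sigbar_pos[of P xmax l Og k] by (simp add: divide_le_eq mult.commute)
  have "?o * ?m \<le> ?m"
    using sigbar_pos[of P xmax l Og k] sigbar_less_1[of P xmax l Og k] order_trans[OF norm_ge_zero fst]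
    by (intro mult_left_le_one_le) auto
  then show "norm (snd (traj P s0 x t l)) \<le> ?m" using snd by linarith
qed

lemma layer_norm_initial_le:
  assumes "l \<in> {1..L}"
  shows "layer_norm P xmax k s0 x l 0 \<le> (1 + 1 / sigbar P xmax l Og k) * state_norm L s0"
proof -
  have "norm (fst (s0 l)) \<le> state_norm L s0" "norm (snd (s0 l)) \<le> state_norm L s0"
    using norm_le_state_norm[OF assms, of s0] norm_fst_le norm_snd_le
    by (metis prod.collapse order_trans)+
  moreover have "0 < sigbar P xmax l Og k" by (rule sigbar_pos)
  ultimately have "norm (snd (s0 l)) / sigbar P xmax l Og k \<le> state_norm L s0 / sigbar P xmax l Og k"
    and "0 \<le> state_norm L s0 / sigbar P xmax l Og k"
    using state_norm_nonneg[of L s0] by (simp_all add: divide_right_mono)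
  then show ?thesis
    using \<open>norm (fst (s0 l)) \<le> state_norm L s0\<close> state_norm_nonneg[of L s0]
    by (auto simp: layer_norm_def distrib_right)
qed

lemma layer_norm_Suc_le:
  assumes xmax: "0 \<le> xmax" and adm: "admissible P xmax L k s0 x" and l: "l \<in> {1..L}"
  shows "layer_norm P xmax k s0 x l (Suc t) \<le> contraction_rate P xmax l k * layer_norm P xmax k s0 x l t
    + sigbar P xmax l Ig k * (Wc_norm P l * layer_drive P s0 x l t + norm (lstm_b P l Cg))"
proof -
  let ?S = "traj P s0 x t"
  define sf si so m where "sf = sigbar P xmax l Fg k" and "si = sigbar P xmax l Ig k"
    and "so = sigbar P xmax l Og k" and "m = layer_norm P xmax k s0 x l t"
  have l1: "1 \<le> l" using l by simp
  have h: "infnorm (snd (?S l)) \<le> eta_prev P xmax l k"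
    using traj_in_Sset[OF xmax adm l] Sset_iff eta_prev_Suc_le[OF xmax] order_trans by blast
  have wx: "\<forall>g i. \<bar>layer_input P (x t) ?S l g $ i\<bar> \<le> Wterm P xmax l g i"
    using adm l1 xmax by (intro abs_layer_input_le_Wterm) (auto simp: admissible_def)
  have next_eq: "traj P s0 x (Suc t) l = cell P l (layer_input P (x t) ?S l) (?S l)"
    using new_state_eq_cell[OF l1] by simp
  have input: "norm (layer_input P (x t) ?S l Cg) \<le> Wc_norm P l * layer_drive P s0 x l t"
    unfolding layer_drive_def traj.simps(2) by (rule norm_layer_input_le)
  note cell_bounds = cell_norm_le[OF wx h, folded next_eq sigbar_def]
  have "norm (fst (traj P s0 x (Suc t) l)) \<le> sf * norm (fst (?S l)) + si * (norm (layer_input P (x t) ?S l Cg)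
      + onorm ((*v) (lstm_U P l Cg)) * norm (snd (?S l)) + norm (lstm_b P l Cg))"
    unfolding sf_def si_def by (rule cell_bounds(1))
  also have "\<dots> \<le> sf * m + si * (Wc_norm P l * layer_drive P s0 x l t
      + onorm ((*v) (lstm_U P l Cg)) * (so * m) + norm (lstm_b P l Cg))"
    unfolding sf_def si_def so_def m_def
    using layer_norm_ge(1,2)[of P s0 x t l xmax k] input less_imp_le[OF sigbar_pos, of P xmax l _ k]
      onorm_pos_le[OF matrix_vector_mul_bounded_linear, of "lstm_U P l Cg"]
    by (intro add_mono mult_left_mono order_refl) auto
  also have "\<dots> = contraction_rate P xmax l k * m + si * (Wc_norm P l * layer_drive P s0 x l t + norm (lstm_b P l Cg))"
    unfolding contraction_rate_def sf_def si_def so_def by (simp add: algebra_simps)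
  finally have c: "norm (fst (traj P s0 x (Suc t) l))
      \<le> contraction_rate P xmax l k * m + si * (Wc_norm P l * layer_drive P s0 x l t + norm (lstm_b P l Cg))" .
  have "norm (snd (traj P s0 x (Suc t) l)) / so \<le> norm (fst (traj P s0 x (Suc t) l))"
    using cell_bounds(2) sigbar_pos[of P xmax l Og k] by (simp add: so_def divide_le_eq mult.commute)
  then show ?thesis
    using c unfolding layer_norm_def[of _ _ _ _ _ _ "Suc t"] by (simp add: m_def si_def so_def)
qed

(* The horizon T \<ge> t in the input term is what lets the bound for layer l at time t + 1
   serve as the input bound of layer l + 1 at time t. *)
definition iss_estimate :: "('x::finite, 'c::finite) lstm \<Rightarrow> real \<Rightarrow> nat \<Rightarrow> nat \<Rightarrow> real
    \<Rightarrow> ((nat \<Rightarrow> (real^'c) \<times> (real^'c)) \<Rightarrow> (nat \<Rightarrow> real^'x) \<Rightarrow> nat \<Rightarrow> real) \<Rightarrow> bool" where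
  "iss_estimate P xmax L k \<mu> f \<longleftrightarrow> (\<exists>K G. 0 \<le> K \<and> 0 \<le> G \<and>
     (\<forall>s0 x T t. admissible P xmax L k s0 x \<longrightarrow> t \<le> T \<longrightarrow>
        f s0 x t \<le> K * \<mu> ^ t * state_norm L s0 + G * input_sup_norm P L x T))"

lemma iss_estimateI:
  assumes "0 \<le> K" "0 \<le> G"
    and "\<And>s0 x T t. admissible P xmax L k s0 x \<Longrightarrow> t \<le> T \<Longrightarrow>
      f s0 x t \<le> K * \<mu> ^ t * state_norm L s0 + G * input_sup_norm P L x T"
  shows "iss_estimate P xmax L k \<mu> f"
  using assms unfolding iss_estimate_def by blast

lemma iss_estimateE:
  assumes "iss_estimate P xmax L k \<mu> f"
  obtains K G where "0 \<le> K" "0 \<le> G"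
    and "\<And>s0 x T t. admissible P xmax L k s0 x \<Longrightarrow> t \<le> T \<Longrightarrow>
      f s0 x t \<le> K * \<mu> ^ t * state_norm L s0 + G * input_sup_norm P L x T"
  using assms unfolding iss_estimate_def by blast

lemma iss_estimate_mono:
  assumes "iss_estimate P xmax L k \<mu> g" "\<And>s0 x t. f s0 x t \<le> g s0 x t"
  shows "iss_estimate P xmax L k \<mu> f"
  using assms(1)
proof (rule iss_estimateE)
  fix K G
  assume "0 \<le> K" "0 \<le> G" and g: "\<And>s0 x T t. admissible P xmax L k s0 x \<Longrightarrow> t \<le> T \<Longrightarrow>
    g s0 x t \<le> K * \<mu> ^ t * state_norm L s0 + G * input_sup_norm P L x T"
  then show ?thesis by (intro iss_estimateI[of K G]) (auto intro: order_trans[OF assms(2) g])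
qed

lemma iss_estimate_add:
  assumes "iss_estimate P xmax L k \<mu> f" "iss_estimate P xmax L k \<mu> g"
  shows "iss_estimate P xmax L k \<mu> (\<lambda>s0 x t. f s0 x t + g s0 x t)"
proof -
  from assms(1) obtain K1 G1 where "0 \<le> K1" "0 \<le> G1"
    and f: "\<And>s0 x T t. admissible P xmax L k s0 x \<Longrightarrow> t \<le> T \<Longrightarrow>
      f s0 x t \<le> K1 * \<mu> ^ t * state_norm L s0 + G1 * input_sup_norm P L x T"
    unfolding iss_estimate_def by blast
  from assms(2) obtain K2 G2 where "0 \<le> K2" "0 \<le> G2"
    and g: "\<And>s0 x T t. admissible P xmax L k s0 x \<Longrightarrow> t \<le> T \<Longrightarrow>
      g s0 x t \<le> K2 * \<mu> ^ t * state_norm L s0 + G2 * input_sup_norm P L x T"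
    unfolding iss_estimate_def by blast
  show ?thesis
  proof (rule iss_estimateI[of "K1 + K2" "G1 + G2"])
    fix s0 x and T t :: nat
    assume "admissible P xmax L k s0 x" "t \<le> T"
    then have "f s0 x t + g s0 x t \<le> (K1 * \<mu> ^ t * state_norm L s0 + G1 * input_sup_norm P L x T)
        + (K2 * \<mu> ^ t * state_norm L s0 + G2 * input_sup_norm P L x T)"
      by (intro add_mono f g)
    then show "f s0 x t + g s0 x t \<le> (K1 + K2) * \<mu> ^ t * state_norm L s0 + (G1 + G2) * input_sup_norm P L x T"
      by (simp add: algebra_simps)
  qed (use \<open>0 \<le> K1\<close> \<open>0 \<le> K2\<close> \<open>0 \<le> G1\<close> \<open>0 \<le> G2\<close> in auto)
qed

lemma iss_estimate_const_mult:
  assumes "0 \<le> c" "iss_estimate P xmax L k \<mu> f"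
  shows "iss_estimate P xmax L k \<mu> (\<lambda>s0 x t. c * f s0 x t)"
  using assms(2)
proof (rule iss_estimateE)
  fix K G
  assume "0 \<le> K" "0 \<le> G" and f: "\<And>s0 x T t. admissible P xmax L k s0 x \<Longrightarrow> t \<le> T \<Longrightarrow>
    f s0 x t \<le> K * \<mu> ^ t * state_norm L s0 + G * input_sup_norm P L x T"
  show ?thesis
  proof (rule iss_estimateI[of "c * K" "c * G"])
    fix s0 x and T t :: nat
    assume "admissible P xmax L k s0 x" "t \<le> T"
    then have "c * f s0 x t \<le> c * (K * \<mu> ^ t * state_norm L s0 + G * input_sup_norm P L x T)"
      by (intro mult_left_mono f assms(1))
    then show "c * f s0 x t \<le> (c * K) * \<mu> ^ t * state_norm L s0 + (c * G) * input_sup_norm P L x T"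
      by (simp add: algebra_simps)
  qed (use assms(1) \<open>0 \<le> K\<close> \<open>0 \<le> G\<close> in auto)
qed

lemma iss_estimate_sum:
  assumes "finite A" "\<And>i. i \<in> A \<Longrightarrow> iss_estimate P xmax L k \<mu> (f i)"
  shows "iss_estimate P xmax L k \<mu> (\<lambda>s0 x t. \<Sum>i\<in>A. f i s0 x t)"
  using assms
proof (induction A rule: finite_induct)
  case empty
  show ?case by (rule iss_estimateI[of 0 0]) auto
next
  case (insert i A)
  then show ?case by (simp add: iss_estimate_add)
qed

lemma iss_estimate_layer_norm_of_drive:
  assumes xmax: "0 \<le> xmax" and l: "l \<in> {1..L}"
    and rate: "contraction_rate P xmax l k < \<mu>" and "\<mu> < 1" and "0 \<le> Kd" "0 \<le> Gd"
    and drive: "\<And>s0 x T t. admissible P xmax L k s0 x \<Longrightarrow> t < T \<Longrightarrow>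
      layer_drive P s0 x l t \<le> Kd * \<mu> ^ t * state_norm L s0 + Gd * input_sup_norm P L x T"
  shows "iss_estimate P xmax L k \<mu> (\<lambda>s0 x. layer_norm P xmax k s0 x l)"
proof -
  define \<rho> si so W where "\<rho> = contraction_rate P xmax l k" and "si = sigbar P xmax l Ig k"
    and "so = sigbar P xmax l Og k" and "W = Wc_norm P l"
  have \<rho>: "0 \<le> \<rho>" "\<rho> < \<mu>" using rate contraction_rate_nonneg by (auto simp: \<rho>_def)
  have si: "0 \<le> si" and so: "0 < so"
    unfolding si_def so_def using sigbar_pos less_imp_le by blast+
  have W: "0 \<le> W" by (simp add: W_def Wc_norm_def onorm_pos_le)
  show ?thesis
  proof (rule iss_estimateI)
    fix s0 x and T t :: nat
    assume adm: "admissible P xmax L k s0 x" and "t \<le> T"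
    define S0 U where "S0 = state_norm L s0" and "U = input_sup_norm P L x T"
    have S0: "0 \<le> S0" and U: "0 \<le> U"
      unfolding S0_def U_def by (rule state_norm_nonneg, rule input_sup_norm_nonneg)
    let ?m = "layer_norm P xmax k s0 x l"
    have step: "?m (Suc t') \<le> \<rho> * ?m t' + (si * W * Kd * S0) * \<mu> ^ t' + si * (W * Gd + 1) * U"
      if "t' < T" for t'
    proof -
      have "?m (Suc t') \<le> \<rho> * ?m t' + si * (W * layer_drive P s0 x l t' + norm (lstm_b P l Cg))"
        using layer_norm_Suc_le[OF xmax adm l] by (simp add: \<rho>_def si_def W_def)
      also have "\<dots> \<le> \<rho> * ?m t' + si * (W * (Kd * \<mu> ^ t' * S0 + Gd * U) + U)"
        using drive[OF adm that] norm_bias_le_input_sup_norm[OF l, of P x T] si W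
        by (intro add_left_mono mult_left_mono add_mono) (auto simp: S0_def U_def)
      finally show ?thesis by (simp add: algebra_simps)
    qed
    have "0 \<le> si * W * Kd * S0" "0 \<le> si * (W * Gd + 1) * U"
      using si W \<open>0 \<le> Kd\<close> \<open>0 \<le> Gd\<close> S0 U by simp_all
    moreover have "0 \<le> ?m 0" by (rule order_trans[OF norm_ge_zero layer_norm_ge(1)])
    ultimately have "?m t \<le> (?m 0 + si * W * Kd * S0 / (\<mu> - \<rho>)) * \<mu> ^ t + si * (W * Gd + 1) * U / (1 - \<rho>)"
      using linear_recurrence_le_geometric[OF \<rho> \<open>\<mu> < 1\<close> _ _ _ step \<open>t \<le> T\<close>] by blast
    also have "\<dots> \<le> (1 + 1 / so + si * W * Kd / (\<mu> - \<rho>)) * \<mu> ^ t * S0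
        + si * (W * Gd + 1) / (1 - \<rho>) * U"
    proof -
      have "?m 0 + si * W * Kd * S0 / (\<mu> - \<rho>) \<le> (1 + 1 / so + si * W * Kd / (\<mu> - \<rho>)) * S0"
        using layer_norm_initial_le[OF l, of P xmax k s0 x] by (simp add: so_def S0_def algebra_simps)
      then show ?thesis using \<rho> by (simp add: mult_right_mono mult_ac)
    qed
    finally show "?m t \<le> (1 + 1 / so + si * W * Kd / (\<mu> - \<rho>)) * \<mu> ^ t * state_norm L s0
        + si * (W * Gd + 1) / (1 - \<rho>) * input_sup_norm P L x T"
      by (simp add: S0_def U_def)
  qed (use \<rho> \<open>\<mu> < 1\<close> si so W \<open>0 \<le> Kd\<close> \<open>0 \<le> Gd\<close> in auto)
qed

lemma iss_estimate_layer_norm: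
  assumes xmax: "0 \<le> xmax" and rates: "\<forall>l\<in>{1..L}. contraction_rate P xmax l k < \<mu>" and "\<mu> < 1"
  shows "l \<in> {1..L} \<Longrightarrow> iss_estimate P xmax L k \<mu> (\<lambda>s0 x. layer_norm P xmax k s0 x l)"
proof (induction l)
  case 0
  then show ?case by simp
next
  case (Suc l)
  have rate: "contraction_rate P xmax (Suc l) k < \<mu>" using rates Suc.prems by blast
  note of_drive = iss_estimate_layer_norm_of_drive[OF xmax Suc.prems rate \<open>\<mu> < 1\<close>]
  show ?case
  proof (cases "l = 0")
    case True
    have "layer_drive P s0 x (Suc l) t \<le> input_sup_norm P L x T" if "t < T" for s0 x T t
      using True norm_le_input_sup_norm[of t T x P L] that by (simp add: layer_drive_def)
    then show ?thesis by (intro of_drive[of 0 1]) auto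
  next
    case False
    then have "l \<in> {1..L}" using Suc.prems by simp
    from Suc.IH[OF this] obtain K G where "0 \<le> K" "0 \<le> G"
      and prev: "\<And>s0 x T t. admissible P xmax L k s0 x \<Longrightarrow> t \<le> T \<Longrightarrow>
        layer_norm P xmax k s0 x l t \<le> K * \<mu> ^ t * state_norm L s0 + G * input_sup_norm P L x T"
      unfolding iss_estimate_def by blast
    have "0 \<le> \<mu>" using rate contraction_rate_nonneg order_trans less_imp_le by metis
    have "layer_drive P s0 x (Suc l) t \<le> (K * \<mu>) * \<mu> ^ t * state_norm L s0 + G * input_sup_norm P L x T"
      if "admissible P xmax L k s0 x" "t < T" for s0 x T t
    proof -
      have "layer_drive P s0 x (Suc l) t = norm (snd (traj P s0 x (Suc t) l))"
        using False by (simp add: layer_drive_def)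
      also have "\<dots> \<le> layer_norm P xmax k s0 x l (Suc t)" by (rule layer_norm_ge(3))
      also have "\<dots> \<le> K * \<mu> ^ Suc t * state_norm L s0 + G * input_sup_norm P L x T"
        using that by (intro prev) auto
      finally show ?thesis by (simp add: ac_simps)
    qed
    then show ?thesis using \<open>0 \<le> K\<close> \<open>0 \<le> G\<close> \<open>0 \<le> \<mu>\<close> by (intro of_drive[of "K * \<mu>" G]) auto
  qed
qed

lemma iss_estimate_state_norm:
  assumes "0 \<le> xmax" "\<forall>l\<in>{1..L}. contraction_rate P xmax l k < \<mu>" "\<mu> < 1"
  shows "iss_estimate P xmax L k \<mu> (\<lambda>s0 x t. state_norm L (traj P s0 x t))"
proof (rule iss_estimate_mono)
  show "iss_estimate P xmax L k \<mu> (\<lambda>s0 x t. \<Sum>l=1..L. 2 * layer_norm P xmax k s0 x l t)"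
    using iss_estimate_layer_norm[OF assms] by (intro iss_estimate_sum iss_estimate_const_mult) auto
  fix s0 x t
  have "norm (traj P s0 x t l) \<le> 2 * layer_norm P xmax k s0 x l t" for l
    using norm_Pair_le[of "fst (traj P s0 x t l)" "snd (traj P s0 x t l)"]
      layer_norm_ge(1,3)[of P s0 x t l xmax k]
    by simp
  then have "(\<Sum>l=1..L. norm (traj P s0 x t l)) \<le> (\<Sum>l=1..L. 2 * layer_norm P xmax k s0 x l t)"
    by (intro sum_mono)
  with state_norm_le_sum show "state_norm L (traj P s0 x t) \<le> (\<Sum>l=1..L. 2 * layer_norm P xmax k s0 x l t)"
    by (rule order_trans)
qed

lemma classKL_geometric:
  assumes "0 < C" "0 < \<mu>" "\<mu> < 1"
  shows "classKL (\<lambda>s t. C * \<mu> ^ t * s)"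
  unfolding classKL_def classK_def
proof (intro conjI allI impI)
  fix t
  show "continuous_on {0..} (\<lambda>s. C * \<mu> ^ t * s)" by (intro continuous_intros)
  show "strict_mono_on {0..} (\<lambda>s. C * \<mu> ^ t * s)"
    using assms by (intro strict_mono_onI) simp
  show "C * \<mu> ^ t * 0 = 0" by simp
next
  fix s :: real
  assume "0 \<le> s"
  show "antimono (\<lambda>t. C * \<mu> ^ t * s)"
    using assms \<open>0 \<le> s\<close> by (intro antimonoI mult_right_mono mult_left_mono power_decreasing) auto
  have "(\<lambda>t. C * \<mu> ^ t * s) \<longlonglongrightarrow> C * 0 * s"
    using assms by (intro tendsto_intros) auto
  then show "(\<lambda>t. C * \<mu> ^ t * s) \<longlonglongrightarrow> 0" by simp
qed

lemma classKinf_linear: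
  assumes "1 \<le> C"
  shows "classKinf (\<lambda>u. C * u)"
  unfolding classKinf_def classK_def
proof (intro conjI allI)
  show "continuous_on {0..} (\<lambda>u. C * u)" by (intro continuous_intros)
  show "strict_mono_on {0..} (\<lambda>u. C * u)" using assms by (intro strict_mono_onI) simp
  show "C * 0 = 0" by simp
  fix M :: real
  have "\<bar>M\<bar> + 1 \<le> C * (\<bar>M\<bar> + 1)" using mult_right_mono[OF assms, of "\<bar>M\<bar> + 1"] by simp
  then show "\<exists>s\<ge>0. M < C * s" by (intro exI[of _ "\<bar>M\<bar> + 1"]) auto
qed

lemma iss_estimate_imp_comparison_bound:
  assumes "iss_estimate P xmax L k \<mu> f" "0 < \<mu>" "\<mu> < 1"
  shows "\<exists>\<beta> \<gamma>. classKL \<beta> \<and> classKinf \<gamma> \<and> (\<forall>s0 x t. admissible P xmax L k s0 x \<longrightarrow>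
    f s0 x t \<le> \<beta> (state_norm L s0) t + \<gamma> (input_sup_norm P L x t))"
  using assms(1)
proof (rule iss_estimateE)
  fix K G
  assume "0 \<le> K" "0 \<le> G" and f: "\<And>s0 x T t. admissible P xmax L k s0 x \<Longrightarrow> t \<le> T \<Longrightarrow>
    f s0 x t \<le> K * \<mu> ^ t * state_norm L s0 + G * input_sup_norm P L x T"
  have "f s0 x t \<le> (K + 1) * \<mu> ^ t * state_norm L s0 + (G + 1) * input_sup_norm P L x t"
    if "admissible P xmax L k s0 x" for s0 x t
  proof -
    have "f s0 x t \<le> K * \<mu> ^ t * state_norm L s0 + G * input_sup_norm P L x t"
      using f[OF that order_refl] .
    also have "\<dots> \<le> (K + 1) * \<mu> ^ t * state_norm L s0 + (G + 1) * input_sup_norm P L x t"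
      using assms(2) state_norm_nonneg[of L s0] input_sup_norm_nonneg[of P L x t]
      by (intro add_mono mult_right_mono) auto
    finally show ?thesis .
  qed
  moreover have "classKL (\<lambda>s t. (K + 1) * \<mu> ^ t * s)"
    using \<open>0 \<le> K\<close> assms(2,3) by (intro classKL_geometric) auto
  moreover have "classKinf (\<lambda>u. (G + 1) * u)"
    using \<open>0 \<le> G\<close> by (intro classKinf_linear) auto
  ultimately show ?thesis by blast
qed

lemma obtain_uniform_bound_less_1:
  fixes f :: "'a \<Rightarrow> real"
  assumes "finite A" "\<forall>a\<in>A. f a < 1"
  obtains \<mu> where "0 < \<mu>" "\<mu> < 1" "\<forall>a\<in>A. f a < \<mu>"
proof -
  define M where "M = Max (insert 0 (f ` A))"
  have "finite (insert 0 (f ` A))" using assms(1) by simp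
  then have "M < 1" "0 \<le> M" "\<forall>a\<in>A. f a \<le> M"
    unfolding M_def using assms(2) by (simp_all add: Max_less_iff)
  then show ?thesis by (intro that[of "(1 + M) / 2"]) auto
qed

theorem theoremB4:
  fixes P :: "('x::finite, 'c::finite) lstm" and L :: nat and xmax :: real and k :: nat
  assumes "xmax > 0"
    and "\<forall>l\<in>{1..L}. spectral_radius (Amat P xmax l k) < 1"
  shows "(\<exists>\<beta> \<gamma>. classKL \<beta> \<and> classKinf \<gamma> \<and>
           (\<forall>s0 x t. (\<forall>l\<in>{1..L}. s0 l \<in> Sset P xmax l k) \<and>
                     (\<forall>\<tau> i. \<bar>x \<tau> $ i\<bar> \<le> xmax) \<longrightarrow>
              state_norm L (traj P s0 x t) \<le> \<beta> (state_norm L s0) t + \<gamma> (input_sup_norm P L x t)))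
       \<and> (\<forall>k' l. l \<in> {1..L} \<longrightarrow>
              spectral_radius (Amat P xmax l (Suc k')) \<le> spectral_radius (Amat P xmax l k'))"
proof
  have xmax: "0 \<le> xmax" using assms(1) by simp
  have "\<forall>l\<in>{1..L}. contraction_rate P xmax l k < 1" using assms(2) by (simp add: spectral_radius_Amat)
  then obtain \<mu> where \<mu>: "0 < \<mu>" "\<mu> < 1" and rates: "\<forall>l\<in>{1..L}. contraction_rate P xmax l k < \<mu>"
    by (rule obtain_uniform_bound_less_1[OF finite_atLeastAtMost])
  have "iss_estimate P xmax L k \<mu> (\<lambda>s0 x t. state_norm L (traj P s0 x t))"
    by (rule iss_estimate_state_norm[OF xmax rates \<mu>(2)])
  from iss_estimate_imp_comparison_bound[OF this \<mu>]
  show "\<exists>\<beta> \<gamma>. classKL \<beta> \<and> classKinf \<gamma> \<and>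
           (\<forall>s0 x t. (\<forall>l\<in>{1..L}. s0 l \<in> Sset P xmax l k) \<and> (\<forall>\<tau> i. \<bar>x \<tau> $ i\<bar> \<le> xmax) \<longrightarrow>
              state_norm L (traj P s0 x t) \<le> \<beta> (state_norm L s0) t + \<gamma> (input_sup_norm P L x t))"
    by (simp add: admissible_def)
  show "\<forall>k' l. l \<in> {1..L} \<longrightarrow> spectral_radius (Amat P xmax l (Suc k')) \<le> spectral_radius (Amat P xmax l k')"
    by (simp add: spectral_radius_Amat contraction_rate_Suc_le[OF xmax])
qed

end
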